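(* Let $\mathfrak a_1,\ldots,\mathfrak a_s$ be nonzero formal Laurent series satisfying property ( * ), $\mathfrak a_i=\dfrac{h(\mathfrak a_i)(t)}{(1-t)^{d_i}}$ with $h(\mathfrak a_i)(t)\in\mathbb C[t,t^{-1}]$. Set $r_i=\deg h(\mathfrak a_i)(t)$, $\alpha_i=d_i-r_i$, $b_i=d_i-1$, assume $b_i\ge0$ for all $i$, let $\sigma_i$ be the least $n$ with $h_n(\mathfrak a_i)\ne0$, and write $$\mathfrak a_1\underline{\otimes}\cdots\underline{\otimes}\mathfrak a_s=\frac{h(\mathfrak a_1\underline{\otimes}\cdots\underline{\otimes}\mathfrak a_s)(t)}{(1-t)^{b_1+\cdots+b_s+1}}.$$ Then: (1) $\deg h(\mathfrak a_1\underline{\otimes}\cdots\underline{\otimes}\mathfrak a_s)\le(b_1+\cdots+b_s+1)-\min(\alpha_1,\ldots,\alpha_s)$. (2) If condition ( ** ) is fulfilled for each of the pairs $$\{\mathfrak a_1,\mathfrak a_2\},\ \{\mathfrak a_1\underline{\otimes}\mathfrak a_2,\mathfrak a_3\},\ \ldots,\ \{\mathfrak a_1\underline{\otimes}\cdots\underline{\otimes}\mathfrak a_{s-1},\mathfrak a_s\},$$ and $h_k(\mathfrak a_i)\ge0$ (real and nonnegative) for all $i$ and $k$, then $$\deg h(\mathfrak a_1\underline{\otimes}\cdots\underline{\otimes}\mathfrak a_s)=(b_1+\cdots+b_s+1)-\max(\alpha_1,\ldots,\alpha_s).$$ (3) If $0\le\sigma_i$ and $r_i<d_i$ for all $i=1,\ldots,s$,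 then condition ( ** ) is fulfilled for each of the pairs $$\{\mathfrak a_1,\mathfrak a_2\},\ \{\mathfrak a_1\underline{\otimes}\mathfrak a_2,\mathfrak a_3\},\ \ldots,\ \{\mathfrak a_1\underline{\otimes}\cdots\underline{\otimes}\mathfrak a_{s-1},\mathfrak a_s\}.$$
   Context: A formal Laurent series $\mathfrak a=\sum_{l\ge\sigma_{\mathfrak a}}a_lt^l$ ($\sigma_{\mathfrak a}\in\mathbb Z$, $a_l\in\mathbb C$) satisfies property ( * ) if $\mathfrak a=\dfrac{h(\mathfrak a)(t)}{(1-t)^{d_{\mathfrak a}}}$ for some integer $d_{\mathfrak a}\ge 0$ and some $h(\mathfrak a)(t)\in\mathbb C[t,t^{-1}]$. Equivalently, there is a polynomial $\Phi_{\mathfrak a}$ with $a_l=\Phi_{\mathfrak a}(l)$ for $l\gg0$; one takes $d_{\mathfrak a}=\deg\Phi_{\mathfrak a}+1$ if $\Phi_{\mathfrak a}\ne0$ and $d_{\mathfrak a}=0$ if $\Phi_{\mathfrak a}=0$ (so $h(\mathfrak a)(1)\ne0$ when $d_{\mathfrak a}>0$). Write $h(\mathfrak a)(t)=\sum_n h_n(\mathfrak a)t^n$. For nonzero $\mathfrak a$ let $\sigma_{\mathfrak a}$ be the least $n$ with $h_n(\mathfrak a)\neq0$, $r_{\mathfrak a}=\deg h(\mathfrak a)(t)$ the largest such $n$, and $b_{\mathfrak a}=d_{\mathfrak a}-1$. The Segre transform of $\mathfrak a=\sum a_lt^l$ and $\mathfrak b=\sum b_lt^l$ is $\mathfrak a\,\underline{\otimes}\,\mathfrak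 b=\sum_{l}a_lb_lt^l$. It again satisfies ( * ), with $d_{\mathfrak a\underline{\otimes}\mathfrak b}=d_{\mathfrak a}+d_{\mathfrak b}-1$ when $d_{\mathfrak a},d_{\mathfrak b}\ge1$. Condition ( ** ) for a pair $\{\mathfrak a,\mathfrak b\}$: $b_{\mathfrak b}+\sigma_{\mathfrak a}-r_{\mathfrak b}\ge0$ and $b_{\mathfrak a}+\sigma_{\mathfrak b}-r_{\mathfrak a}\ge0$. *)

theory Defs
  imports
    Complex_Main
    "HOL-Computational_Algebra.Formal_Laurent_Series"
    "HOL-Library.Nonpos_Ints"
begin

definition is_laurent_poly :: "complex fls \<Rightarrow> bool" where
  "is_laurent_poly h \<longleftrightarrow> finite {n. fls_nth h n \<noteq> 0}"

text \<open>Only meaningful for nonzero Laurent polynomials.\<close>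
definition laurent_degree :: "complex fls \<Rightarrow> int" where
  "laurent_degree h = Max {n. fls_nth h n \<noteq> 0}"

text \<open>Property (*).\<close>
definition star :: "complex fls \<Rightarrow> bool" where
  "star a \<longleftrightarrow> (\<exists>(d::nat) h. is_laurent_poly h \<and> a = h / (1 - fls_X) ^ d)"

text \<open>The polynomial \<open>\<Phi>\<close> that gives the coefficients of \<open>a\<close> in all large degrees. It is unique,
  since two complex polynomials that agree at infinitely many integers are equal, and it exists
  when \<open>a\<close> has property (*).\<close>
definition coeff_poly :: "complex fls \<Rightarrow> complex poly" where
  "coeff_poly a = (THE p. eventually (\<lambda>l::int. fls_nth a l = poly p (of_int l)) at_top)"

definition d_of :: "complex fls \<Rightarrow> nat" where
  "d_of a = (if coeff_poly a = 0 then 0 else degree (coeff_poly a) + 1)"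

text \<open>The numerator \<open>h(a)\<close> over the denominator \<open>(1 - t) ^ d_of a\<close>.\<close>
definition h_of :: "complex fls \<Rightarrow> complex fls" where
  "h_of a = a * (1 - fls_X) ^ d_of a"

definition sigma_of :: "complex fls \<Rightarrow> int" where
  "sigma_of a = fls_subdegree (h_of a)"

definition r_of :: "complex fls \<Rightarrow> int" where
  "r_of a = laurent_degree (h_of a)"

text \<open>An integer, since it is \<open>-1\<close> when \<open>d_of a = 0\<close>.\<close>
definition b_of :: "complex fls \<Rightarrow> int" where
  "b_of a = int (d_of a) - 1"

definition alpha_of :: "complex fls \<Rightarrow> int" where
  "alpha_of a = int (d_of a) - r_of a"

lift_definition segre :: "complex fls \<Rightarrow> complex fls \<Rightarrow> complex fls" is
  "\<lambda>f g n. f n * g n"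
  by (auto elim: MOST_mono)

lemma fls_nth_segre [simp]: "fls_nth (segre a b) n = fls_nth a n * fls_nth b n"
  by transfer simp

text \<open>The Segre transform of \<open>a 1, \<dots>, a k\<close> for \<open>k \<ge> 1\<close>. There is no empty product, because the
  constant sequence 1 on all integers is not a Laurent series.\<close>
definition segre_prod :: "(nat \<Rightarrow> complex fls) \<Rightarrow> nat \<Rightarrow> complex fls" where
  "segre_prod a k = foldl segre (a 1) (map a [2..<Suc k])"

text \<open>Condition (**).\<close>
definition star_star :: "complex fls \<Rightarrow> complex fls \<Rightarrow> bool" where
  "star_star a b \<longleftrightarrow>
     b_of b + sigma_of a - r_of b \<ge> 0 \<and> b_of a + sigma_of b - r_of a \<ge> 0"

end

theory Submission
  imports Defs
begin

text \<open>Let \<open>\<Phi>\<close> be the coefficient polynomial of \<open>a\<close>, of degree \<open>d - 1\<close>. Multiplying by \<open>(1 - t) ^ d\<close>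
  takes the \<open>d\<close>-th backward difference of the coefficients, which kills \<open>\<Phi>\<close>; hence the degree \<open>r\<close>
  of the numerator is \<open>d + m\<close>, where \<open>m = - \<alpha>\<close> is the last index with \<open>a\<^sub>m \<noteq> \<Phi>(m)\<close>.
  Beyond the largest of the indices \<open>- \<alpha>\<^sub>i\<close> all factors agree with their polynomials, so the Segre
  product agrees with the product polynomial, which is (1). Part (3) follows from this bound, since
  there every \<open>- \<alpha>\<^sub>i\<close> is negative and every \<open>\<sigma>\<^sub>i\<close> is nonnegative. Under (**), every index between
  \<open>- \<alpha>\<^sub>a\<close> and \<open>- \<alpha>\<^sub>b\<close> is a zero of one of the two coefficient polynomials, so the last deviation
  of the product is at the smaller of the two indices, provided that neither polynomial vanishes
  there; this is what nonnegativity of the numerators gives.\<close>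

section \<open>Backward differences of coefficient sequences\<close>

definition backward_diff :: "(int \<Rightarrow> complex) \<Rightarrow> int \<Rightarrow> complex" where
  "backward_diff f n = f n - f (n - 1)"

lemma backward_diff_pow_diff:
  "(backward_diff ^^ d) (\<lambda>n. f n - g n) m = (backward_diff ^^ d) f m - (backward_diff ^^ d) g m"
  by (induction d arbitrary: m) (simp_all add: backward_diff_def)

lemma fls_nth_mult_one_minus_X:
  "fls_nth (a * (1 - fls_X)) = backward_diff (fls_nth (a :: complex fls))"
  by (auto simp: fun_eq_iff backward_diff_def algebra_simps fls_X_times_conv_shift)

lemma fls_nth_mult_one_minus_X_pow:
  "fls_nth (a * (1 - fls_X) ^ d) = (backward_diff ^^ d) (fls_nth (a :: complex fls))"
proof (induction d)
  case (Suc d)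
  have "a * (1 - fls_X) ^ Suc d = a * (1 - fls_X) ^ d * (1 - fls_X)"
    by (simp add: mult_ac)
  then show ?case
    using Suc by (simp only: fls_nth_mult_one_minus_X) simp
qed simp

text \<open>If \<open>e\<close> stops at \<open>m\<close>, its difference at \<open>m + 1\<close> is
  \<open>- e m\<close>: each application moves the last place up by one and flips the sign.\<close>

lemma backward_diff_pow_last:
  assumes "\<And>l. l > m \<Longrightarrow> e l = 0"
  shows "l > m + int d \<Longrightarrow> (backward_diff ^^ d) e l = 0"
    and "(backward_diff ^^ d) e (m + int d) = (- 1) ^ d * e m"
proof -
  have "(\<forall>l > m + int d. (backward_diff ^^ d) e l = 0) \<and>
        (backward_diff ^^ d) e (m + int d) = (- 1) ^ d * e m"
    using assms by (induction d) (auto simp: backward_diff_def algebra_simps)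
  then show "l > m + int d \<Longrightarrow> (backward_diff ^^ d) e l = 0"
    "(backward_diff ^^ d) e (m + int d) = (- 1) ^ d * e m" by auto
qed

text \<open>p(x) and p(x - 1) share their leading coefficient, so a difference lowers the degree of
  a nonconstant p and kills a constant.\<close>

lemma backward_diff_pow_poly:
  assumes "degree p < d"
  shows "(backward_diff ^^ d) (\<lambda>n. poly p (of_int n)) = (\<lambda>_. 0)"
  using assms
proof (induction d arbitrary: p)
  case (Suc d)
  have zero: "(backward_diff ^^ k) (\<lambda>_. 0) = (\<lambda>_. 0)" for k
    by (induction k) (auto simp: backward_diff_def fun_eq_iff)
  define q where "q = p - pcompose p [:-1, 1:]"
  have q: "backward_diff (\<lambda>n. poly p (of_int n)) = (\<lambda>n. poly q (of_int n))"
    by (auto simp: backward_diff_def q_def poly_pcompose fun_eq_iff algebra_simps)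
  have step: "(backward_diff ^^ Suc d) (\<lambda>n. poly p (of_int n)) =
      (backward_diff ^^ d) (\<lambda>n. poly q (of_int n))"
    by (simp only: funpow_Suc_right o_apply q)
  show ?case
  proof (cases "degree p = 0")
    case True
    then obtain c where "p = [:c:]" by (metis degree_eq_zeroE)
    then have "q = 0" by (simp add: q_def)
    then show ?thesis using step zero by simp
  next
    case False
    have deg: "degree (pcompose p [:-1, 1:]) = degree p" by (simp add: degree_pcompose)
    have "coeff (pcompose p [:-1, 1:]) (degree p) = lead_coeff p"
      using lead_coeff_comp[of "[:-1, 1:]" p] deg by simp
    then have "coeff q (degree p) = 0" by (simp add: q_def)
    moreover have "degree q \<le> degree p"
      unfolding q_def by (rule order_trans[OF degree_diff_le_max]) (simp add: deg)
    \<comment> \<open>With equal degrees \<open>q\<close> would have leading coefficient 0, forcing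
      \<open>q = 0\<close> and \<open>degree p = 0\<close>.\<close>
    ultimately have "degree q < degree p"
      using False by (metis degree_0 leading_coeff_0_iff le_neq_implies_less neq0_conv)
    then show ?thesis using Suc step by simp
  qed
qed simp

section \<open>Eventual agreement with a polynomial\<close>

definition eventually_poly :: "complex fls \<Rightarrow> complex poly \<Rightarrow> bool" where
  "eventually_poly a p \<longleftrightarrow> eventually (\<lambda>l::int. fls_nth a l = poly p (of_int l)) at_top"

text \<open>The root set is finite. Below the support of a series this supplies an index where a
  nonzero polynomial differs from the coefficient 0.\<close>

lemma poly_nonzero_below:
  fixes p :: "complex poly"
  assumes "p \<noteq> 0"
  obtains l :: int where "l < N" "poly p (of_int l) \<noteq> 0"
proof (rule ccontr)
  assume "\<not> thesis"
  with that have "of_int ` {..<N} \<subseteq> {x. poly p x = 0}" by auto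
  moreover have "infinite ((of_int :: int \<Rightarrow> complex) ` {..<N})"
    using infinite_Iio by (subst finite_image_iff) (auto simp: inj_on_def)
  ultimately show False using poly_roots_finite[OF assms] finite_subset by blast
qed

lemma eventually_poly_unique:
  assumes "eventually_poly a p" "eventually_poly a q"
  shows "p = q"
proof (rule ccontr)
  assume "p \<noteq> q"
  have "eventually (\<lambda>l::int. poly p (of_int l) = poly q (of_int l)) at_top"
    using assms unfolding eventually_poly_def by eventually_elim simp
  then obtain N where N: "\<And>l::int. l \<ge> N \<Longrightarrow> poly (p - q) (of_int l) = 0"
    by (auto simp: eventually_at_top_linorder)
  then have "of_int ` {N..} \<subseteq> {x. poly (p - q) x = 0}" by auto
  moreover have "infinite ((of_int :: int \<Rightarrow> complex) ` {N..})"
    using infinite_Ici by (subst finite_image_iff) (auto simp: inj_on_def)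
  ultimately show False
    using poly_roots_finite[of "p - q"] \<open>p \<noteq> q\<close> finite_subset by (metis eq_iff_diff_eq_0)
qed

lemma coeff_poly_eq: "eventually_poly a p \<Longrightarrow> coeff_poly a = p"
  unfolding coeff_poly_def
  by (rule the_equality) (auto simp: eventually_poly_def[symmetric] eventually_poly_unique)

lemma eventually_poly_segre:
  "eventually_poly a p \<Longrightarrow> eventually_poly b q \<Longrightarrow> eventually_poly (segre a b) (p * q)"
  unfolding eventually_poly_def by (erule (1) eventually_elim2) simp

section \<open>Degree of the numerator and last deviation\<close>

lemma laurent_degree_eqI:
  assumes "\<And>l. l > m \<Longrightarrow> fls_nth h l = 0" "fls_nth h m \<noteq> 0"
  shows "is_laurent_poly h" "laurent_degree h = m"
proof -
  have "{n. fls_nth h n \<noteq> 0} \<subseteq> {fls_subdegree h..m}"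
    using assms(1) by (force simp: not_less[symmetric] intro: fls_eq0_below_subdegree)
  then have fin: "finite {n. fls_nth h n \<noteq> 0}" using finite_subset by blast
  then show "is_laurent_poly h" by (simp add: is_laurent_poly_def)
  show "laurent_degree h = m"
    unfolding laurent_degree_def using assms fin by (intro Max_eqI) (auto simp: not_less[symmetric])
qed

lemma alpha_of_eqI:
  assumes "coeff_poly a \<noteq> 0"
    and "\<And>l. l > m \<Longrightarrow> fls_nth a l = poly (coeff_poly a) (of_int l)"
    and "fls_nth a m \<noteq> poly (coeff_poly a) (of_int m)"
  shows "is_laurent_poly (h_of a)" "alpha_of a = - m"
proof -
  define e where "e l = fls_nth a l - poly (coeff_poly a) (of_int l)" for l
  have e: "e l = 0" if "l > m" for l using assms(2) that by (simp add: e_def)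
  \<comment> \<open>As the polynomial is nonzero, \<open>d_of a\<close> is its degree plus one,
    enough differences to kill it.\<close>
  have "(backward_diff ^^ d_of a) (\<lambda>n. poly (coeff_poly a) (of_int n)) = (\<lambda>_. 0)"
    using assms(1) by (intro backward_diff_pow_poly) (simp add: d_of_def)
  then have h: "fls_nth (h_of a) n = (backward_diff ^^ d_of a) e n" for n
    by (simp add: h_of_def fls_nth_mult_one_minus_X_pow e_def[abs_def] backward_diff_pow_diff)
  have "fls_nth (h_of a) l = 0" if "l > m + int (d_of a)" for l
    using backward_diff_pow_last(1)[of m e, OF e that] h by simp
  moreover have "fls_nth (h_of a) (m + int (d_of a)) \<noteq> 0"
    using backward_diff_pow_last(2)[of m e, OF e] h assms(3) by (simp add: e_def)
  ultimately have "is_laurent_poly (h_of a)" "laurent_degree (h_of a) = m + int (d_of a)"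
    using laurent_degree_eqI by blast+
  then show "is_laurent_poly (h_of a)" "alpha_of a = - m"
    by (simp_all add: alpha_of_def r_of_def)
qed

lemma eventually_poly_last_deviation:
  assumes "eventually_poly a p" "p \<noteq> 0"
  obtains m where "\<And>l. l > m \<Longrightarrow> fls_nth a l = poly p (of_int l)"
    and "fls_nth a m \<noteq> poly p (of_int m)"
proof -
  obtain N where N: "\<And>l. l \<ge> N \<Longrightarrow> fls_nth a l = poly p (of_int l)"
    using assms(1) by (auto simp: eventually_poly_def eventually_at_top_linorder)
  obtain l0 where l0: "l0 < fls_subdegree a" "poly p (of_int l0) \<noteq> 0"
    using poly_nonzero_below[OF assms(2)] by blast
  \<comment> \<open>The deviations are unbounded below, so the set is cut off at the deviation
    \<open>l0\<close> to have a maximum.\<close>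
  define B where "B = {l. l \<ge> l0 \<and> fls_nth a l \<noteq> poly p (of_int l)}"
  have "B \<subseteq> {l0..N}" using N by (force simp: B_def not_less[symmetric])
  then have fin: "finite B" using finite_subset by blast
  have "l0 \<in> B" using l0 by (simp add: B_def)
  with fin have "Max B \<in> B" by (intro Max_in) auto
  moreover from fin \<open>l0 \<in> B\<close> have "l0 \<le> Max B" by (rule Max_ge)
  moreover have "fls_nth a l = poly p (of_int l)" if "l > Max B" for l
  proof (rule ccontr)
    assume "fls_nth a l \<noteq> poly p (of_int l)"
    then have "l \<in> B" using that \<open>l0 \<le> Max B\<close> by (simp add: B_def)
    then show False using fin that by (metis Max_ge not_less)
  qed
  ultimately show thesis using that[of "Max B"] unfolding B_def by blast
qed

text \<open>A last deviation exists, and \<open>alpha_of_eqI\<close> identifies it as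
  \<open>- alpha_of a\<close>.\<close>

lemma
  assumes "eventually_poly a p" "p \<noteq> 0"
  shows is_laurent_poly_h_of: "is_laurent_poly (h_of a)"
    and nth_eq_poly_above_alpha: "\<And>l. l > - alpha_of a \<Longrightarrow> fls_nth a l = poly p (of_int l)"
    and nth_neq_poly_at_alpha: "fls_nth a (- alpha_of a) \<noteq> poly p (of_int (- alpha_of a))"
proof -
  obtain m where m: "\<And>l. l > m \<Longrightarrow> fls_nth a l = poly p (of_int l)"
    "fls_nth a m \<noteq> poly p (of_int m)"
    using eventually_poly_last_deviation[OF assms] by blast
  have *: "coeff_poly a = p" using assms by (simp add: coeff_poly_eq)
  note alpha_of_eqI[of a m, unfolded *, OF assms(2) m]
  then show "is_laurent_poly (h_of a)"
    "\<And>l. l > - alpha_of a \<Longrightarrow> fls_nth a l = poly p (of_int l)"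
    "fls_nth a (- alpha_of a) \<noteq> poly p (of_int (- alpha_of a))"
    using m by auto
qed

section \<open>Lowest exponent, and recovery of a series from its numerator\<close>

lemma one_minus_fls_X_nonzero: "(1 - fls_X :: complex fls) \<noteq> 0"
  by (metis fls_X_subdegree fls_one_subdegree right_minus_eq zero_neq_one)

text \<open>The factor 1 - t has subdegree 0, so multiplying by its powers does not move the lowest
  exponent.\<close>

lemma sigma_of_eq: "sigma_of a = fls_subdegree a"
proof (cases "a = 0")
  case False
  have "fls_subdegree (1 - fls_X :: complex fls) = 0"
    by (rule fls_subdegree_eqI) auto
  then show ?thesis using False
    using one_minus_fls_X_nonzero
    by (simp add: sigma_of_def h_of_def fls_subdegree_pow)
qed (simp add: sigma_of_def h_of_def)

lemma h_of_div: "a = h_of a / (1 - fls_X) ^ d_of a"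
  unfolding h_of_def
  by (simp only: nonzero_mult_div_cancel_right[OF power_not_zero[OF one_minus_fls_X_nonzero]])

section \<open>Coefficient polynomials as sums of binomial coefficients\<close>

text \<open>The range of the convolution depends on \<open>l\<close>; the support of
  \<open>h\<close> does not, so polynomials in \<open>l\<close> can be summed over it.\<close>

lemma fls_nth_mult_fps_to_fls:
  assumes "is_laurent_poly h"
  shows "fls_nth (h * fps_to_fls g) l =
    (\<Sum>n | fls_nth h n \<noteq> 0. fls_nth h n * (if n \<le> l then fps_nth g (nat (l - n)) else 0))"
proof -
  have fin: "finite {n. fls_nth h n \<noteq> 0}" using assms by (simp add: is_laurent_poly_def)
  have "fls_nth (h * fps_to_fls g) l =
      (\<Sum>n = fls_subdegree h..l - fls_subdegree (fps_to_fls g).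
        fls_nth h n * fls_nth (fps_to_fls g) (l - n))"
    by (rule fls_times_nth)
  also have "\<dots> = (\<Sum>n | fls_nth h n \<noteq> 0. fls_nth h n * fls_nth (fps_to_fls g) (l - n))"
  proof (rule sum.mono_neutral_cong)
    fix n assume n: "n \<in> {n. fls_nth h n \<noteq> 0} - {fls_subdegree h..l - fls_subdegree (fps_to_fls g)}"
    then have "fls_subdegree h \<le> n" by (auto intro: fls_subdegree_leI)
    with n have "l - n < fls_subdegree (fps_to_fls g)" by auto
    then show "fls_nth h n * fls_nth (fps_to_fls g) (l - n) = 0"
      by (simp only: fls_eq0_below_subdegree mult_zero_right)
  qed (use fin in auto)
  also have "\<dots> = (\<Sum>n | fls_nth h n \<noteq> 0.
      fls_nth h n * (if n \<le> l then fps_nth g (nat (l - n)) else 0))"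
    by (intro sum.cong) auto
  finally show ?thesis .
qed

text \<open>Its value at \<open>l\<close> is the binomial coefficient of \<open>l - n + b\<close>
  over \<open>b\<close>, which for \<open>l\<close> \<ge> \<open>n\<close> is the coefficient of t^l
  in t^n / (1 - t)^(b + 1).\<close>

definition shifted_binomial_poly :: "nat \<Rightarrow> int \<Rightarrow> complex poly" where
  "shifted_binomial_poly b n =
     smult (1 / fact b) (\<Prod>i = 0..<b. [:of_nat b - of_int n - of_nat i, 1:])"

lemma poly_shifted_binomial_poly:
  "poly (shifted_binomial_poly b n) (of_int l) = of_int (l - n + int b) gchoose b"
  by (simp add: shifted_binomial_poly_def poly_prod gbinomial_prod_rev algebra_simps)

text \<open>Expand 1 / (1 - t)^(b + 1) by the negative binomial series \<open>g\<close>. Once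
  \<open>l\<close> has passed the support of \<open>h\<close>, every monomial of \<open>h\<close>
  contributes its binomial polynomial.\<close>

lemma eventually_poly_laurent_poly_div:
  assumes h: "is_laurent_poly h" and a: "a = h / (1 - fls_X) ^ Suc b"
  shows "eventually_poly a
    (\<Sum>n | fls_nth h n \<noteq> 0. smult (fls_nth h n) (shifted_binomial_poly b n))"
proof -
  let ?S = "{n. fls_nth h n \<noteq> 0}"
  have fin: "finite ?S" using h by (simp add: is_laurent_poly_def)
  define g :: "complex fps" where "g = Abs_fps (\<lambda>k. of_nat ((b + k) choose b))"
  have "(b + k) choose k = (b + k) choose b" for k
    using binomial_symmetric[of k "b + k"] by simp
  then have "inverse ((1 - fps_X) ^ Suc b) = g"
    using one_minus_const_fps_X_neg_power'[of "Suc b" "1 :: complex"] by (simp add: g_def)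
  moreover have "fps_nth ((1 - fps_X :: complex fps) ^ Suc b) 0 \<noteq> 0"
    by (simp add: fps_power_zeroth)
  ultimately have "(1 - fps_X) ^ Suc b * g = 1"
    by (metis inverse_mult_eq_1')
  then have "fps_to_fls ((1 - fps_X) ^ Suc b * g) = 1" by simp
  then have "(1 - fls_X) ^ Suc b * fps_to_fls g = 1"
    by (simp add: fls_times_fps_to_fls fps_to_fls_power del: power_Suc)
  then have ag: "a = h * fps_to_fls g"
    unfolding a divide_inverse by (simp only: inverse_unique)
  \<comment> \<open>For empty support \<open>Max ?S\<close> is an unspecified integer; this is
    harmless, since both sides are then 0 for every \<open>l\<close>.\<close>
  have "fls_nth a l =
      poly (\<Sum>n\<in>?S. smult (fls_nth h n) (shifted_binomial_poly b n)) (of_int l)"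
    if l: "l \<ge> Max ?S" for l
  proof -
    have "(if n \<le> l then fps_nth g (nat (l - n)) else 0)
        = poly (shifted_binomial_poly b n) (of_int l)" if "n \<in> ?S" for n
    proof -
      have "n \<le> l" using l fin that Max_ge order_trans by blast
      then have "of_int (l - n + int b) = (of_nat (b + nat (l - n)) :: complex)"
        by simp
      then show ?thesis using \<open>n \<le> l\<close>
        unfolding poly_shifted_binomial_poly by (simp add: g_def binomial_gbinomial add.commute)
    qed
    then show ?thesis
      unfolding ag fls_nth_mult_fps_to_fls[OF h] by (simp add: poly_sum)
  qed
  then show ?thesis
    unfolding eventually_poly_def eventually_at_top_linorder by blast
qed

lemma star_eventually_poly:
  assumes "star a" "b_of a \<ge> 0"
  shows "eventually_poly a (coeff_poly a)" "coeff_poly a \<noteq> 0"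
proof -
  \<comment> \<open>This exponent \<open>d\<close> need not be \<open>d_of a\<close>; it may be 0,
    and then the series is a Laurent polynomial with coefficient polynomial 0.\<close>
  obtain d h where h: "is_laurent_poly h" "a = h / (1 - fls_X) ^ d"
    using assms(1) by (auto simp: star_def)
  have "\<exists>p. eventually_poly a p"
  proof (cases d)
    case 0
    have fin: "finite {n. fls_nth h n \<noteq> 0}" using h by (simp add: is_laurent_poly_def)
    have "fls_nth a l = 0" if "l > Max {n. fls_nth h n \<noteq> 0}" for l
      using h(2) 0 that fin by (metis (mono_tags, lifting) Max_ge div_by_1 mem_Collect_eq not_less power_0)
    then have "eventually_poly a 0"
      unfolding eventually_poly_def eventually_at_top_dense by auto
    then show ?thesis ..
  next
    case (Suc b)
    then show ?thesis using eventually_poly_laurent_poly_div h by blast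
  qed
  then show "eventually_poly a (coeff_poly a)" using coeff_poly_eq by blast
  \<comment> \<open>The zero polynomial would give \<open>d_of a = 0\<close> and hence
    \<open>b_of a = -1\<close>.\<close>
  show "coeff_poly a \<noteq> 0" using assms(2) by (auto simp: b_of_def d_of_def)
qed

text \<open>Nonnegativity of the numerator need not be known for the partial Segre products: this weaker
  condition is all that (2) needs, and it passes to Segre products under (**).\<close>
definition nonvanishing_left :: "complex fls \<Rightarrow> bool" where
  "nonvanishing_left a \<longleftrightarrow>
     (\<forall>l. l < - alpha_of a \<and> l < sigma_of a \<longrightarrow> poly (coeff_poly a) (of_int l) \<noteq> 0)"

text \<open>Nothing cancels: for \<open>l\<close> below the support of the numerator all nonzero
  binomial terms have the sign (-1)^b, and \<open>l < - alpha_of a\<close> makes the term of top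
  exponent nonzero.\<close>

lemma nonvanishing_left_if_nonneg:
  assumes ep: "eventually_poly a (coeff_poly a)" and nz: "coeff_poly a \<noteq> 0"
    and nonneg: "\<And>k. fls_nth (h_of a) k \<in> \<real>\<^sub>\<ge>\<^sub>0"
  shows "nonvanishing_left a"
  unfolding nonvanishing_left_def
proof (intro allI impI, elim conjE)
  fix l assume l: "l < - alpha_of a" "l < sigma_of a"
  define h b where "h = h_of a" and "b = degree (coeff_poly a)"
  let ?S = "{n. fls_nth h n \<noteq> 0}"
  have d: "d_of a = Suc b" using nz by (simp add: d_of_def b_def)
  have lp: "is_laurent_poly h" unfolding h_def using is_laurent_poly_h_of[OF ep nz] .
  then have fin: "finite ?S" by (simp add: is_laurent_poly_def)
  have a: "a = h / (1 - fls_X) ^ Suc b"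
    using h_of_div[of a] by (simp only: h_def d)
  have Phi: "coeff_poly a = (\<Sum>n\<in>?S. smult (fls_nth h n) (shifted_binomial_poly b n))"
    using eventually_poly_laurent_poly_div[OF lp a] by (rule coeff_poly_eq)
  have gt: "n > l" if "n \<in> ?S" for n
    using that l(2) fls_subdegree_leI[of h n] by (simp add: sigma_of_def h_def)
  define c where "c n = Re (fls_nth h n) * real (nat (n - l - 1) choose b)" for n
  have "a \<noteq> 0"
    using ep nz coeff_poly_eq[of a 0] by (auto simp: eventually_poly_def)
  then have "h \<noteq> 0" using a by (metis div_0)
  then have "?S \<noteq> {}" by (auto simp: fls_eq_iff)
  then have r: "r_of a \<in> ?S"
    using Max_in[OF fin] by (simp add: r_of_def laurent_degree_def h_def)
  have nn: "Re (fls_nth h n) \<ge> 0" for n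
    using nonneg[of n] by (auto simp: h_def complex_nonneg_Reals_iff)
  have h_eq: "fls_nth h n = of_real (Re (fls_nth h n))" for n
    using nonneg[of n] by (auto simp: h_def complex_nonneg_Reals_iff complex_eq_iff)
  \<comment> \<open>\<open>- alpha_of a\<close> is \<open>r_of a - b - 1\<close>, so the binomial
    coefficient at the top exponent is positive.\<close>
  have "b \<le> nat (r_of a - l - 1)"
    using l(1) by (simp add: alpha_of_def d)
  then have "c (r_of a) > 0"
    using r nn[of "r_of a"] h_eq[of "r_of a"] unfolding c_def
    by (intro mult_pos_pos) (auto simp: less_le)
  then have pos: "(\<Sum>n\<in>?S. c n) > 0"
    using r fin nn by (intro sum_pos2[of _ "r_of a"]) (auto simp: c_def)
  \<comment> \<open>Negating the upper index gives all nonzero terms of the polynomial at \<open>l\<close> the same sign.\<close>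
  have "fls_nth h n * poly (shifted_binomial_poly b n) (of_int l) = (-1) ^ b * of_real (c n)"
    if "n \<in> ?S" for n
  proof -
    have "of_nat b - of_int (l - n + int b) - 1 = (of_nat (nat (n - l - 1)) :: complex)"
      using gt[OF that] by simp
    then have "poly (shifted_binomial_poly b n) (of_int l)
        = (-1) ^ b * of_nat (nat (n - l - 1) choose b)"
      unfolding poly_shifted_binomial_poly
      by (subst gbinomial_negated_upper) (simp only: binomial_gbinomial)
    then show ?thesis
      by (subst h_eq) (simp add: c_def)
  qed
  then have "poly (coeff_poly a) (of_int l) = (-1) ^ b * of_real (\<Sum>n\<in>?S. c n)"
    unfolding Phi by (simp add: poly_sum sum_distrib_left)
  then show "poly (coeff_poly a) (of_int l) \<noteq> 0" using pos by (simp del: of_real_sum)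
qed

section \<open>Segre products under \<open>star_star\<close>\<close>

text \<open>Since \<open>b_of\<close> is \<open>d_of\<close> minus 1, the weak inequalities become
  strict: each last deviation comes before the support of the other series.\<close>

lemma star_star_iff: "star_star a b \<longleftrightarrow> - alpha_of b < sigma_of a \<and> - alpha_of a < sigma_of b"
  by (auto simp: star_star_def b_of_def alpha_of_def)

lemma segre_star_star:
  assumes a: "eventually_poly a (coeff_poly a)" "coeff_poly a \<noteq> 0" "nonvanishing_left a"
    and b: "eventually_poly b (coeff_poly b)" "coeff_poly b \<noteq> 0" "nonvanishing_left b"
    and ss: "star_star a b"
  shows "alpha_of (segre a b) = max (alpha_of a) (alpha_of b)" "nonvanishing_left (segre a b)"
proof -
  have cp: "coeff_poly (segre a b) = coeff_poly a * coeff_poly b"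
    using a b by (intro coeff_poly_eq eventually_poly_segre)
  note na = nth_eq_poly_above_alpha[OF a(1,2)] and nb = nth_eq_poly_above_alpha[OF b(1,2)]
  have ss': "- alpha_of b < sigma_of a" "- alpha_of a < sigma_of b"
    using ss by (auto simp: star_star_iff)
  have za: "fls_nth a l = 0" if "l \<le> - alpha_of b" for l
    using ss' that by (simp add: sigma_of_eq)
  have zb: "fls_nth b l = 0" if "l \<le> - alpha_of a" for l
    using ss' that by (simp add: sigma_of_eq)
  define m where "m = min (- alpha_of a) (- alpha_of b)"
  \<comment> \<open>Up to the larger last deviation, the series with the smaller one already agrees
    with its polynomial and still has coefficient 0, so both sides vanish.\<close>
  have "fls_nth (segre a b) l = poly (coeff_poly (segre a b)) (of_int l)" if "l > m" for l
    using na[of l] nb[of l] za[of l] zb[of l] that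
    by (cases "l > - alpha_of a"; cases "l > - alpha_of b") (auto simp: cp m_def)
  \<comment> \<open>If \<open>m\<close> is the last deviation of \<open>a\<close>, the coefficient
    there is 0, so the polynomial is not; if \<open>m\<close> is smaller,
    \<open>nonvanishing_left\<close> applies.\<close>
  moreover have "poly (coeff_poly a) (of_int m) \<noteq> 0"
  proof (cases "m = - alpha_of a")
    case True
    then show ?thesis
      using nth_neq_poly_at_alpha[OF a(1,2)] za[of m] by (simp add: m_def)
  next
    case False
    then have "m < - alpha_of a" "m < sigma_of a" using ss' by (auto simp: m_def)
    then show ?thesis using a(3) by (simp add: nonvanishing_left_def)
  qed
  moreover have "poly (coeff_poly b) (of_int m) \<noteq> 0"
  proof (cases "m = - alpha_of b")
    case True
    then show ?thesis
      using nth_neq_poly_at_alpha[OF b(1,2)] zb[of m] by (simp add: m_def)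
  next
    case False
    then have "m < - alpha_of b" "m < sigma_of b" using ss' by (auto simp: m_def)
    then show ?thesis using b(3) by (simp add: nonvanishing_left_def)
  qed
  ultimately show *: "alpha_of (segre a b) = max (alpha_of a) (alpha_of b)"
    using alpha_of_eqI(2)[of "segre a b" m] a b za[of m] by (auto simp: cp m_def min_def max_def)
  show "nonvanishing_left (segre a b)"
    unfolding nonvanishing_left_def *
  proof (intro allI impI, elim conjE)
    fix l assume "l < - max (alpha_of a) (alpha_of b)"
    \<comment> \<open>The bounds by \<open>sigma_of\<close> come crosswise from
      \<open>star_star\<close>: \<open>l\<close> lies below the last deviation of the other
      factor.\<close>
    then have "l < - alpha_of a" "l < sigma_of a" "l < - alpha_of b" "l < sigma_of b"
      using ss' by auto
    then show "poly (coeff_poly (segre a b)) (of_int l) \<noteq> 0"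
      using a(3) b(3) by (simp add: cp nonvanishing_left_def)
  qed
qed

section \<open>Iterated Segre products and the three claims\<close>

lemma segre_prod_1: "segre_prod a (Suc 0) = a 1"
  by (simp add: segre_prod_def)

lemma segre_prod_Suc:
  "k \<ge> 1 \<Longrightarrow> segre_prod a (Suc k) = segre (segre_prod a k) (a (Suc k))"
  by (simp add: segre_prod_def)

lemma fls_nth_segre_prod:
  "k \<ge> 1 \<Longrightarrow> fls_nth (segre_prod a k) l = (\<Prod>i = 1..k. fls_nth (a i) l)"
  by (induction k rule: nat_induct_at_least)
    (simp_all add: segre_prod_1 segre_prod_Suc mult.commute)

theorem proposition3p7:
  fixes s :: nat and a :: "nat \<Rightarrow> complex fls"
  assumes "s \<ge> 1"
    and "\<And>i. i \<in> {1..s} \<Longrightarrow> a i \<noteq> 0"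
    and "\<And>i. i \<in> {1..s} \<Longrightarrow> star (a i)"
    and "\<And>i. i \<in> {1..s} \<Longrightarrow> b_of (a i) \<ge> 0"
  shows
    "(is_laurent_poly (h_of (segre_prod a s)) \<and>
      segre_prod a s =
        h_of (segre_prod a s) / (1 - fls_X) powi ((\<Sum>i=1..s. b_of (a i)) + 1)) \<and>
     laurent_degree (h_of (segre_prod a s))
       \<le> ((\<Sum>i=1..s. b_of (a i)) + 1) - Min ((\<lambda>i. alpha_of (a i)) ` {1..s}) \<and>
     ((\<forall>k\<in>{1..<s}. star_star (segre_prod a k) (a (Suc k))) \<and>
      (\<forall>i\<in>{1..s}. \<forall>k. fls_nth (h_of (a i)) k \<in> \<real>\<^sub>\<ge>\<^sub>0) \<longrightarrow>
        laurent_degree (h_of (segre_prod a s))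
          = ((\<Sum>i=1..s. b_of (a i)) + 1) - Max ((\<lambda>i. alpha_of (a i)) ` {1..s})) \<and>
     ((\<forall>i\<in>{1..s}. 0 \<le> sigma_of (a i) \<and> r_of (a i) < int (d_of (a i))) \<longrightarrow>
        (\<forall>k\<in>{1..<s}. star_star (segre_prod a k) (a (Suc k))))"
proof -
  define P where "P = segre_prod a"
  define \<Phi> where "\<Phi> k = (\<Prod>i = 1..k. coeff_poly (a i))" for k
  have ep: "eventually_poly (a i) (coeff_poly (a i))" "coeff_poly (a i) \<noteq> 0"
    if "i \<in> {1..s}" for i
    using star_eventually_poly assms(3,4) that by blast+
  have epP: "eventually_poly (P k) (\<Phi> k)" if "k \<in> {1..s}" for k
  proof -
    have "k \<ge> 1" using that by simp
    then have "k \<le> s \<longrightarrow> eventually_poly (P k) (\<Phi> k)"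
    proof (induction k rule: nat_induct_at_least)
      case base
      show ?case using ep(1)[of 1] by (simp add: P_def \<Phi>_def segre_prod_1)
    next
      case (Suc k)
      then show ?case
        using eventually_poly_segre[of "P k" "\<Phi> k" "a (Suc k)" "coeff_poly (a (Suc k))"]
          ep(1)[of "Suc k"]
        by (auto simp: P_def \<Phi>_def segre_prod_Suc mult.commute)
    qed
    then show ?thesis using that by simp
  qed
  have nzP: "\<Phi> k \<noteq> 0" if "k \<in> {1..s}" for k
    using ep(2) that by (auto simp: \<Phi>_def)
  have cpP: "coeff_poly (P k) = \<Phi> k" if "k \<in> {1..s}" for k
    using epP[OF that] by (rule coeff_poly_eq)
  \<comment> \<open>Needed for all partial products because of (3). Otherwise every factor, and so
    \<open>P k\<close>, would agree with its polynomial at the last deviation of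
    \<open>P k\<close>.\<close>
  have bound: "\<exists>i\<in>{1..k}. alpha_of (a i) \<le> alpha_of (P k)" if k: "k \<in> {1..s}" for k
  proof (rule ccontr)
    assume *: "\<not> ?thesis"
    have "fls_nth (a i) (- alpha_of (P k)) = poly (coeff_poly (a i)) (of_int (- alpha_of (P k)))"
      if "i \<in> {1..k}" for i
    proof (rule nth_eq_poly_above_alpha)
      have "alpha_of (P k) < alpha_of (a i)" using * that by (meson not_le)
      then show "- alpha_of (P k) > - alpha_of (a i)" by simp
    qed (use ep that k in auto)
    then have "fls_nth (P k) (- alpha_of (P k)) = poly (\<Phi> k) (of_int (- alpha_of (P k)))"
      using k by (simp add: P_def fls_nth_segre_prod \<Phi>_def poly_prod)
    then show False using nth_neq_poly_at_alpha epP nzP k by blast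
  qed
  have s: "s \<in> {1..s}" using assms(1) by simp
  \<comment> \<open>Degrees of nonzero polynomials add, so the prescribed exponent is
    \<open>d_of (P s)\<close> and the prescribed numerator is \<open>h_of (P s)\<close>.\<close>
  have deg: "int (d_of (P s)) = (\<Sum>i=1..s. b_of (a i)) + 1"
  proof -
    have "degree (\<Phi> s) = (\<Sum>i=1..s. degree (coeff_poly (a i)))"
      unfolding \<Phi>_def using ep(2) by (intro degree_prod_eq_sum_degree) auto
    moreover have "b_of (a i) = int (degree (coeff_poly (a i)))" if "i \<in> {1..s}" for i
      using ep(2)[OF that] by (simp add: b_of_def d_of_def)
    ultimately show ?thesis using cpP[OF s] nzP[OF s] by (simp add: d_of_def)
  qed
  have ld: "laurent_degree (h_of (P s)) = (\<Sum>i=1..s. b_of (a i)) + 1 - alpha_of (P s)"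
    using deg by (simp add: alpha_of_def r_of_def)
  have part1: "laurent_degree (h_of (P s))
       \<le> ((\<Sum>i=1..s. b_of (a i)) + 1) - Min ((\<lambda>i. alpha_of (a i)) ` {1..s})"
  proof -
    obtain i where i: "i \<in> {1..s}" "alpha_of (a i) \<le> alpha_of (P s)" using bound[OF s] by blast
    then have "Min ((\<lambda>i. alpha_of (a i)) ` {1..s}) \<le> alpha_of (a i)" by (intro Min_le) auto
    then show ?thesis using i ld by linarith
  qed
  have part0: "is_laurent_poly (h_of (P s))"
    "P s = h_of (P s) / (1 - fls_X) powi ((\<Sum>i=1..s. b_of (a i)) + 1)"
    using is_laurent_poly_h_of[OF epP nzP] s h_of_div[of "P s"]
    by (simp_all only: deg[symmetric] power_int_of_nat)
  have part2: "laurent_degree (h_of (P s))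
          = ((\<Sum>i=1..s. b_of (a i)) + 1) - Max ((\<lambda>i. alpha_of (a i)) ` {1..s})"
    if ss: "\<And>k. k \<in> {1..<s} \<Longrightarrow> star_star (P k) (a (Suc k))"
      and nn: "\<And>i k. i \<in> {1..s} \<Longrightarrow> fls_nth (h_of (a i)) k \<in> \<real>\<^sub>\<ge>\<^sub>0"
  proof -
    have na: "nonvanishing_left (a i)" if "i \<in> {1..s}" for i
      using nonvanishing_left_if_nonneg ep nn that by blast
    \<comment> \<open>\<open>nonvanishing_left\<close> is carried along because the next factor
      requires it of the partial product.\<close>
    have "k \<le> s \<longrightarrow> alpha_of (P k) = Max ((\<lambda>i. alpha_of (a i)) ` {1..k}) \<and> nonvanishing_left (P k)"
      if "k \<ge> 1" for k
      using that
    proof (induction k rule: nat_induct_at_least)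
      case base
      show ?case using na[of 1] by (simp add: P_def segre_prod_1)
    next
      case (Suc k)
      show ?case
      proof
        assume ks: "Suc k \<le> s"
        have k: "k \<in> {1..s}" using Suc.hyps ks by simp
        have *: "alpha_of (P (Suc k)) = max (alpha_of (P k)) (alpha_of (a (Suc k)))"
          "nonvanishing_left (P (Suc k))"
          using segre_star_star[of "P k" "a (Suc k)"] epP[OF k] nzP[OF k] cpP[OF k] ep[of "Suc k"]
            na[of "Suc k"] ss[of k] Suc ks
          by (auto simp: P_def segre_prod_Suc)
        have "{1..Suc k} = insert (Suc k) {1..k}" by auto
        then have "Max ((\<lambda>i. alpha_of (a i)) ` {1..Suc k})
          = max (alpha_of (a (Suc k))) (Max ((\<lambda>i. alpha_of (a i)) ` {1..k}))"
          using Suc.hyps by simp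
        then show "alpha_of (P (Suc k)) = Max ((\<lambda>i. alpha_of (a i)) ` {1..Suc k}) \<and>
            nonvanishing_left (P (Suc k))"
          using * Suc ks by (simp add: max.commute)
      qed
    qed
    then show ?thesis using ld assms(1) by simp
  qed
  have part3: "star_star (P k) (a (Suc k))"
    if H: "\<And>i. i \<in> {1..s} \<Longrightarrow> 0 \<le> sigma_of (a i) \<and> r_of (a i) < int (d_of (a i))"
      and k: "k \<in> {1..<s}" for k
  proof -
    have al: "alpha_of (a i) > 0" if "i \<in> {1..s}" for i
      using H[OF that] by (simp add: alpha_of_def)
    obtain i where "i \<in> {1..k}" "alpha_of (a i) \<le> alpha_of (P k)"
      using bound[of k] k by auto
    then have "alpha_of (P k) > 0" using al[of i] k by simp
    moreover have "sigma_of (P k) \<ge> 0"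
    \<comment> \<open>A zero product has subdegree 0 by convention; otherwise the factor
      \<open>a 1\<close> already kills all negative indices.\<close>
    proof (cases "P k = 0")
      case False
      have "fls_nth (P k) l = 0" if "l < 0" for l
      proof -
        have "fls_nth (a 1) l = 0"
          using H[of 1] that k by (simp add: sigma_of_eq)
        then show ?thesis using k by (auto simp: P_def fls_nth_segre_prod)
      qed
      then show ?thesis
        unfolding sigma_of_eq using False by (intro fls_subdegree_geI)
    qed (simp add: sigma_of_eq)
    ultimately show ?thesis
      using al[of "Suc k"] H[of "Suc k"] k by (simp add: star_star_iff)
  qed
  show ?thesis
    using part0 part1 part2 part3 unfolding P_def by blast
qed

end
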